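(* Let $E$ and $F$ be Hausdorff locally convex spaces over $\mathbb{K}\in\{\mathbb{R},\mathbb{C}\}$ such that $F$ is a quasi-(LB) space, with quasi-(LB) representation $\{A_\alpha:\alpha\in\mathbb{N}^{\mathbb{N}}\}$, and $E$ has a sequential web. Let $H$ be a fast closed linear subspace of $F$ and let $T:H\to E$ be a surjective linear map whose graph is closed in $H\times E$. For $k,m_1,\dots,m_k\in\mathbb{N}$ put $$V_{m_1\cdots m_k}=\bigcup\{T(A_\alpha\cap H):\alpha=(a_n)\in\mathbb{N}^{\mathbb{N}},\ a_n=m_n \text{ for } n=1,\dots,k\},$$ and assume that there is a sequence $(r_k)\in\mathbb{N}^{\mathbb{N}}$ such that for every $k\in\mathbb{N}$ the closure $\overline{V_{r_1\cdots r_k}}$ in $E$ is a neighborhood of $0$ in $E$. Then: (a) Every convergent sequence in $E$ is the image under $T$ of a sequence in $H$ that is fast convergent in $F$ (that is, if $(y_n)$ converges in $E$, there is a sequence $(u_n)$ in $H$, fast convergent in $F$, with $T(u_n)=y_n$ for all $n$). (b) If each precompact subset of $E$ is contained in the absolutely convex hull of a null sequence in $E$, then every precompact subset of $E$ is the image under $T$ of a subset of $H$ that is fast precompact in $F$. (c) If in addition $E$ is metrizable, then every Cauchy sequence in $E$ is the image under $T$ of a sequence in $H$ that is fast convergent in $F$.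
   Context: All spaces are Hausdorff locally convex topological vector spaces over $\mathbb{K}=\mathbb{R}$ or $\mathbb{C}$. A disk is an absolutely convex (convex and balanced) set. Banach disks. For a bounded disk $B$ in a space $E$, $E_B$ denotes the linear span of $B$ with the norm $\|x\|_B=\inf\{t>0:x\in tB\}$. $B$ is a Banach disk if $(E_B,\|\cdot\|_B)$ is complete. A sequence in $E$ is fast convergent (to $y$) if for some Banach disk $B$ in $E$ it converges to $y$ in $(E_B,\|\cdot\|_B)$. A subset $A\subset E$ is fast precompact if for some Banach disk $B$ in $E$, $A$ is (contained in $E_B$ and) precompact in $(E_B,\|\cdot\|_B)$. A linear subspace $H$ of a space $F$ is fast closed if for every Banach disk $B$ of $F$, $H\cap F_B$ is a closed subspace of $F$. Quasi-(LB) spaces. For $\alpha=(a_n),\beta=(b_n)\in\mathbb{N}^{\mathbb{N}}$ write $\alpha\le\beta$ if $a_n\le b_n$ for all $n$. A quasi-(LB) representation on $F$ is a family $\{A_\alpha:\alpha\in\mathbb{N}^{\mathbb{N}}\}$ of Banach disks of $F$ with $\bigcup_\alpha A_\alpha=F$ and $A_\alpha\subset A_\beta$ whenever $\alpha\le\beta$. A space having such a representation is a quasi-(LB) space. Webs. A web $\mathcal{W}$ on a space $E$ is a countable collection of absolutely convex sets $W_{n_1\cdots n_k}$ ($k,n_1,\dots,n_k\in\mathbb{N}$) such that: (1) $W_{n_1\cdots n_{k+1}}\subset\frac12 W_{n_1\cdots n_k}$ always; (2) $\bigcup_{n_1}W_{n_1}$ is absorbing in $E$; (3) for all $k,n_1,\dots,n_k$,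 $\bigcup_{n_{k+1}}W_{n_1\cdots n_{k+1}}$ is absorbing in $W_{n_1\cdots n_k}$ (i.e. it absorbs each point of $W_{n_1\cdots n_k}$). For $(n_k)\in\mathbb{N}^{\mathbb{N}}$, the sequence $(W_k)_{k}$ with $W_k=W_{n_1\cdots n_k}$ is called a strand. The web is compatible if for every zero neighborhood $V$ in $E$ and every strand $(W_k)$ there is $K\in\mathbb{N}$ with $W_K\subset V$. The web is sequential if it is compatible and for every null sequence $(x_n)$ in $E$ there is a strand $(W_k)$ such that for every $k\in\mathbb{N}$ there is $N_k\in\mathbb{N}$ with $x_n\in W_k$ for all $n\ge N_k$. *)

theory Defs
  imports "HOL-Analysis.Analysis"
begin

text \<open>
  The scalar fields \<open>\<real>\<close> and \<open>\<complex>\<close>, with their usual absolute values: either every scalar is real,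
  or the field is \<open>\<real>[i]\<close>.
\<close>

class real_or_complex = real_normed_field +
  assumes real_or_complex:
    "(\<forall>z. \<exists>a. z = a *\<^sub>R 1) \<or>
     (\<exists>i. i * i = - 1 \<and>
       (\<forall>z. \<exists>a b. z = a *\<^sub>R 1 + b *\<^sub>R i \<and> norm z = sqrt (a\<^sup>2 + b\<^sup>2)))"

instance real :: real_or_complex
  by standard simp

instance complex :: real_or_complex
proof
  have "z = Re z *\<^sub>R 1 + Im z *\<^sub>R \<i> \<and> norm z = sqrt ((Re z)\<^sup>2 + (Im z)\<^sup>2)" for z
    by (simp add: complex_eq_iff cmod_def)
  then show "(\<forall>z :: complex. \<exists>a. z = a *\<^sub>R 1) \<or>
     (\<exists>i :: complex. i * i = - 1 \<and>
       (\<forall>z. \<exists>a b. z = a *\<^sub>R 1 + b *\<^sub>R i \<and> norm z = sqrt (a\<^sup>2 + b\<^sup>2)))"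
    by (intro disjI2 exI[of _ \<i>]) (auto simp only: i_squared)
qed

text \<open>
  A Hausdorff locally convex space over \<open>'k\<close> is carried by a type.  The class
  \<^class>\<open>real_vector\<close> supplies the restriction of the scalar multiplication to the reals, and
  \<^class>\<open>uniform_topological_group_add\<close> the translation-invariant uniformity determined by the
  topology, to which \<^const>\<open>Cauchy\<close> and \<^const>\<open>totally_bounded\<close> refer.
\<close>

locale hausdorff_lcs = vector_space sc
  for sc :: "'k::real_or_complex \<Rightarrow> 'a \<Rightarrow>
      'a::{real_vector, topological_ab_group_add, uniform_topological_group_add, t2_space}" +
  assumes sc_of_real: "sc (of_real t) x = t *\<^sub>R x"
    and continuous_sc: "continuous_on UNIV (\<lambda>(c, x). sc c x)"
    and locally_convex:
      "\<lbrakk>open (U :: 'a set); 0 \<in> U\<rbrakk> \<Longrightarrow> \<exists>V. open V \<and> 0 \<in> V \<and> convex V \<and> V \<subseteq> U"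

text \<open>Absolutely convex sets are taken to be nonempty, so they contain \<open>0\<close>.\<close>

definition disk :: "('k::real_or_complex \<Rightarrow> 'a \<Rightarrow> 'a::real_vector) \<Rightarrow> 'a set \<Rightarrow> bool" where
  "disk sc S \<longleftrightarrow> S \<noteq> {} \<and> convex S \<and> (\<forall>c. norm c \<le> 1 \<longrightarrow> sc c ` S \<subseteq> S)"

definition absorbs :: "('k::real_or_complex \<Rightarrow> 'a \<Rightarrow> 'a) \<Rightarrow> 'a set \<Rightarrow> 'a set \<Rightarrow> bool" where
  "absorbs sc S P \<longleftrightarrow> (\<exists>\<rho>>0. \<forall>c. \<rho> \<le> norm c \<longrightarrow> P \<subseteq> sc c ` S)"

definition tvs_bounded ::
  "('k::real_or_complex \<Rightarrow> 'a \<Rightarrow> 'a::{topological_space, zero}) \<Rightarrow> 'a set \<Rightarrow> bool" where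
  "tvs_bounded sc S \<longleftrightarrow> (\<forall>U. open U \<and> 0 \<in> U \<longrightarrow> absorbs sc U S)"


subsection \<open>Banach disks\<close>

abbreviation disk_span ::
  "('k::real_or_complex \<Rightarrow> 'a \<Rightarrow> 'a::real_vector) \<Rightarrow> 'a set \<Rightarrow> 'a set" where
  "disk_span sc B \<equiv> module.span sc B"

text \<open>
  The value \<open>0\<close> outside the span of \<open>B\<close> is a convention: it makes the induced distance
  nonnegative on the whole type, as \<^locale>\<open>Metric_space\<close> requires.
\<close>

definition disk_norm ::
  "('k::real_or_complex \<Rightarrow> 'a \<Rightarrow> 'a::real_vector) \<Rightarrow> 'a set \<Rightarrow> 'a \<Rightarrow> real" where
  "disk_norm sc B x =
     (if x \<in> disk_span sc B then Inf {t. 0 < t \<and> x \<in> (\<lambda>b. t *\<^sub>R b) ` B} else 0)"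

abbreviation disk_dist ::
  "('k::real_or_complex \<Rightarrow> 'a \<Rightarrow> 'a::real_vector) \<Rightarrow> 'a set \<Rightarrow> 'a \<Rightarrow> 'a \<Rightarrow> real" where
  "disk_dist sc B \<equiv> \<lambda>x y. disk_norm sc B (x - y)"

abbreviation disk_topology ::
  "('k::real_or_complex \<Rightarrow> 'a \<Rightarrow> 'a::real_vector) \<Rightarrow> 'a set \<Rightarrow> 'a topology" where
  "disk_topology sc B \<equiv> Metric_space.mtopology (disk_span sc B) (disk_dist sc B)"

lemma disk_scaleD: "disk sc B \<Longrightarrow> norm c \<le> 1 \<Longrightarrow> b \<in> B \<Longrightarrow> sc c b \<in> B"
  unfolding disk_def by blast

lemma (in hausdorff_lcs) disk_span_explicit:
  assumes B: "disk sc B" and x: "x \<in> span B"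
  shows "\<exists>t>0. x \<in> (\<lambda>b. t *\<^sub>R b) ` B"
  using x
proof (induction rule: span_induct_alt)
  case base
  obtain b where b: "b \<in> B" using B by (auto simp: disk_def)
  have "sc 0 b \<in> B" by (rule disk_scaleD[OF B _ b]) simp
  then have "0 \<in> B" by simp
  then show ?case by (intro exI[of _ 1]) auto
next
  case (step c b y)
  then obtain t d where t: "t > 0" "d \<in> B" "y = t *\<^sub>R d" by auto
  define s where "s = norm c + 1"
  have s: "s > 0" unfolding s_def by (smt (verit) norm_ge_zero)
  define e where "e = sc (c / of_real s) b"
  have "norm (c / of_real s) \<le> 1"
    using s by (simp add: norm_divide s_def)
  then have e: "e \<in> B" using disk_scaleD[OF B] step.hyps unfolding e_def by blast
  have "sc c b = sc (of_real s * (c / of_real s)) b" using s by simp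
  also have "\<dots> = sc (of_real s) e" by (simp only: e_def scale_scale)
  finally have ce: "sc c b = s *\<^sub>R e" by (simp add: sc_of_real)
  define z where "z = (s / (s + t)) *\<^sub>R e + (t / (s + t)) *\<^sub>R d"
  have "z \<in> B" unfolding z_def
    using B e t s by (intro convexD) (auto simp: disk_def simp flip: add_divide_distrib)
  moreover have "sc c b + y = (s + t) *\<^sub>R z"
    using s t by (simp add: ce z_def scaleR_add_right)
  ultimately show ?case using s t by (intro exI[of _ "s + t"]) auto
qed

text \<open>For a bounded disk \<open>B\<close> the distance really is a metric, so the general notions of
  \<^locale>\<open>Metric_space\<close> have their intended meaning.\<close>

lemma (in hausdorff_lcs) Metric_space_disk:
  assumes B: "disk sc B" and bdd: "tvs_bounded sc B"
  shows "Metric_space (disk_span sc B) (disk_dist sc B)"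
proof -
  define G where "G x = {t. 0 < t \<and> x \<in> (\<lambda>b. t *\<^sub>R b) ` B}" for x
  have norm_eq: "disk_norm sc B x = (if x \<in> span B then Inf (G x) else 0)" for x
    by (simp add: disk_norm_def G_def)
  have G_ne: "G x \<noteq> {}" if "x \<in> span B" for x
    using disk_span_explicit[OF B that] by (auto simp: G_def)
  have G_bdd: "bdd_below (G x)" for x
    by (rule bdd_belowI[of _ 0]) (auto simp: G_def)
  have neg: "- b \<in> B" if "b \<in> B" for b
  proof -
    have "sc (of_real (-1)) b \<in> B" by (rule disk_scaleD[OF B _ that]) simp
    then show ?thesis by (simp only: sc_of_real) simp
  qed
  have G_minus: "G (- x) = G x" for x
  proof -
    have "G x \<subseteq> G (- x)" for x
      using neg unfolding G_def by (auto simp: image_iff) (metis scaleR_minus_right)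
    from this[of x] this[of "- x"] show ?thesis by auto
  qed
  have norm_minus: "disk_norm sc B (- x) = disk_norm sc B x" for x
    using span_neg[of x B] span_neg[of "- x" B] by (auto simp: norm_eq G_minus)
  have nonneg: "0 \<le> disk_norm sc B x" for x
    using G_ne[of x] by (auto simp: norm_eq G_def intro!: cInf_greatest)
  have tri: "disk_norm sc B (x + y) \<le> disk_norm sc B x + disk_norm sc B y"
    if xy: "x \<in> span B" "y \<in> span B" for x y
  proof -
    have sum: "s + t \<in> G (x + y)" if "s \<in> G x" "t \<in> G y" for s t
    proof -
      from that obtain a b where ab: "s > 0" "t > 0" "a \<in> B" "b \<in> B" "x = s *\<^sub>R a" "y = t *\<^sub>R b"
        by (auto simp: G_def)
      define z where "z = (s / (s + t)) *\<^sub>R a + (t / (s + t)) *\<^sub>R b"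
      have "z \<in> B" unfolding z_def
        using B ab by (intro convexD) (auto simp: disk_def simp flip: add_divide_distrib)
      moreover have "x + y = (s + t) *\<^sub>R z"
        using ab by (simp add: z_def scaleR_add_right)
      ultimately show ?thesis using ab by (auto simp: G_def)
    qed
    have "Inf (G (x + y)) - t \<le> Inf (G x)" if "t \<in> G y" for t
    proof (rule cInf_greatest[OF G_ne[OF xy(1)]])
      fix s assume "s \<in> G x"
      from cInf_lower[OF sum[OF this that] G_bdd] show "Inf (G (x + y)) - t \<le> s" by simp
    qed
    then have "Inf (G (x + y)) - Inf (G x) \<le> t" if "t \<in> G y" for t
      using that by (smt (verit))
    then have "Inf (G (x + y)) - Inf (G x) \<le> Inf (G y)"
      by (intro cInf_greatest[OF G_ne[OF xy(2)]])
    then show ?thesis using xy span_add[OF xy] by (simp add: norm_eq)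
  qed
  have zero: "disk_norm sc B 0 = 0"
  proof -
    obtain b where b: "b \<in> B" using B by (auto simp: disk_def)
    have "sc 0 b \<in> B" by (rule disk_scaleD[OF B _ b]) simp
    then have "0 \<in> B" by simp
    then have G0: "t \<in> G 0" if "t > 0" for t using that by (auto simp: G_def image_iff)
    have "Inf (G 0) \<le> t" if "t > 0" for t using cInf_lower[OF G0[OF that] G_bdd] .
    then have "Inf (G 0) \<le> 0" using dense_ge by blast
    then show ?thesis using nonneg[of 0] by (simp add: norm_eq span_zero)
  qed
  have pos: "x = 0" if x: "x \<in> span B" "disk_norm sc B x = 0" for x
  proof (rule ccontr)
    assume "x \<noteq> 0"
    then obtain U where U: "open U" "0 \<in> U" "x \<notin> U"
      using t1_space[of 0 x] by auto
    then obtain \<rho> where \<rho>: "\<rho> > 0" "\<And>c. \<rho> \<le> norm c \<Longrightarrow> B \<subseteq> sc c ` U"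
      using bdd unfolding tvs_bounded_def absorbs_def by meson
    have "Inf (G x) < 1 / \<rho>" using x \<rho> by (simp add: norm_eq)
    then obtain t where t: "t \<in> G x" "t < 1 / \<rho>"
      using cInf_lessD[OF G_ne[OF x(1)]] by blast
    then obtain b where b: "t > 0" "b \<in> B" "x = t *\<^sub>R b" by (auto simp: G_def)
    have "\<rho> \<le> norm (of_real (1 / t) :: 'k)"
      using t(2) b(1) \<rho>(1) by (simp add: norm_divide field_simps)
    from \<rho>(2)[OF this] b(2) obtain u where u: "u \<in> U" "b = sc (of_real (1 / t)) u" by auto
    then have "x = u" using b by (simp only: sc_of_real) simp
    with u U show False by simp
  qed
  show ?thesis
  proof
    show "0 \<le> disk_dist sc B x y" for x y by (rule nonneg)
    show "disk_dist sc B x y = disk_dist sc B y x" for x y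
      using norm_minus[of "x - y"] by simp
    show "disk_dist sc B x y = 0 \<longleftrightarrow> x = y" if "x \<in> span B" "y \<in> span B" for x y
      using pos[of "x - y"] span_diff[OF that] zero by auto
    show "disk_dist sc B x z \<le> disk_dist sc B x y + disk_dist sc B y z"
      if "x \<in> span B" "y \<in> span B" "z \<in> span B" for x y z
      using tri[of "x - y" "y - z"] span_diff that by simp
  qed
qed

definition banach_disk ::
  "('k::real_or_complex \<Rightarrow> 'a \<Rightarrow> 'a::{real_vector, topological_space}) \<Rightarrow> 'a set \<Rightarrow> bool" where
  "banach_disk sc B \<longleftrightarrow> disk sc B \<and> tvs_bounded sc B \<and>
     Metric_space.mcomplete (disk_span sc B) (disk_dist sc B)"

definition fast_convergent ::
  "('k::real_or_complex \<Rightarrow> 'a \<Rightarrow> 'a::{real_vector, topological_space}) \<Rightarrow> (nat \<Rightarrow> 'a) \<Rightarrow> bool" where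
  "fast_convergent sc u \<longleftrightarrow>
     (\<exists>B y. banach_disk sc B \<and> range u \<subseteq> disk_span sc B \<and>
        limitin (disk_topology sc B) u y sequentially)"

definition fast_precompact ::
  "('k::real_or_complex \<Rightarrow> 'a \<Rightarrow> 'a::{real_vector, topological_space}) \<Rightarrow> 'a set \<Rightarrow> bool" where
  "fast_precompact sc P \<longleftrightarrow>
     (\<exists>B. banach_disk sc B \<and> P \<subseteq> disk_span sc B \<and>
        Metric_space.mtotally_bounded (disk_span sc B) (disk_dist sc B) P)"

definition fast_closed ::
  "('k::real_or_complex \<Rightarrow> 'a \<Rightarrow> 'a::{real_vector, topological_space}) \<Rightarrow> 'a set \<Rightarrow> bool" where
  "fast_closed sc H \<longleftrightarrow>
     (\<forall>B. banach_disk sc B \<longrightarrow> closedin (disk_topology sc B) (H \<inter> disk_span sc B))"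


subsection \<open>Quasi-(LB) representations\<close>

definition quasi_LB_representation ::
  "('k::real_or_complex \<Rightarrow> 'a \<Rightarrow> 'a::{real_vector, topological_space}) \<Rightarrow>
   ((nat \<Rightarrow> nat) \<Rightarrow> 'a set) \<Rightarrow> bool" where
  "quasi_LB_representation sc A \<longleftrightarrow>
     (\<forall>\<alpha>. banach_disk sc (A \<alpha>)) \<and> (\<Union>\<alpha>. A \<alpha>) = UNIV \<and> (\<forall>\<alpha> \<beta>. \<alpha> \<le> \<beta> \<longrightarrow> A \<alpha> \<subseteq> A \<beta>)"

text \<open>The set \<open>V\<close> with indices \<open>m\<^sub>1 \<dots> m\<^sub>k\<close>, where \<open>ms\<close> is the list of the \<open>m\<^sub>i\<close>.\<close>

definition prefix_image ::
  "('a \<Rightarrow> 'b) \<Rightarrow> 'a set \<Rightarrow> ((nat \<Rightarrow> nat) \<Rightarrow> 'a set) \<Rightarrow> nat list \<Rightarrow> 'b set" where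
  "prefix_image T H A ms = (\<Union>\<alpha>\<in>{\<alpha>. \<forall>i<length ms. \<alpha> i = ms ! i}. T ` (A \<alpha> \<inter> H))"


subsection \<open>Webs\<close>

text \<open>
  A web is indexed by the nonempty lists of natural numbers; its value at the empty list is
  irrelevant.
\<close>

definition web ::
  "('k::real_or_complex \<Rightarrow> 'a \<Rightarrow> 'a::real_vector) \<Rightarrow> (nat list \<Rightarrow> 'a set) \<Rightarrow> bool" where
  "web sc W \<longleftrightarrow>
     (\<forall>ns. ns \<noteq> [] \<longrightarrow> disk sc (W ns)) \<and>
     (\<forall>ns n. ns \<noteq> [] \<longrightarrow> W (ns @ [n]) \<subseteq> (\<lambda>x. (1/2) *\<^sub>R x) ` W ns) \<and>
     (\<forall>x. absorbs sc (\<Union>n. W [n]) {x}) \<and>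
     (\<forall>ns. ns \<noteq> [] \<longrightarrow> (\<forall>x\<in>W ns. absorbs sc (\<Union>n. W (ns @ [n])) {x}))"

definition strand :: "(nat list \<Rightarrow> 'a set) \<Rightarrow> (nat \<Rightarrow> nat) \<Rightarrow> nat \<Rightarrow> 'a set" where
  "strand W \<nu> k = W (map \<nu> [0..<k])"

definition compatible_web ::
  "('k::real_or_complex \<Rightarrow> 'a \<Rightarrow> 'a::{real_vector, topological_space}) \<Rightarrow>
   (nat list \<Rightarrow> 'a set) \<Rightarrow> bool" where
  "compatible_web sc W \<longleftrightarrow> web sc W \<and>
     (\<forall>V \<nu>. 0 \<in> interior V \<longrightarrow> (\<exists>K\<ge>1. strand W \<nu> K \<subseteq> V))"

definition sequential_web ::
  "('k::real_or_complex \<Rightarrow> 'a \<Rightarrow> 'a::{real_vector, topological_space}) \<Rightarrow>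
   (nat list \<Rightarrow> 'a set) \<Rightarrow> bool" where
  "sequential_web sc W \<longleftrightarrow> compatible_web sc W \<and>
     (\<forall>x. x \<longlonglongrightarrow> 0 \<longrightarrow> (\<exists>\<nu>. \<forall>k\<ge>1. \<exists>N. \<forall>n\<ge>N. x n \<in> strand W \<nu> k))"

end

theory Submission
  imports Defs
begin

text \<open>
  Write \<open>V\<^sub>k\<close> for the image with prefix \<open>r\<^sub>1 \<dots> r\<^sub>k\<close>.  The key step is an open mapping argument giving
  \<open>closure V\<^sub>k \<subseteq> 3 V\<^sub>k\<close>, so that the \<open>V\<^sub>k\<close> themselves are neighbourhoods of \<open>0\<close>: a point of the closure
  is written as a series with terms in \<open>T (2\<^sup>-\<^sup>j A \<alpha>\<^sub>j \<inter> H)\<close>, where \<open>\<alpha>\<^sub>j\<close> agrees with \<open>r\<close> on longer and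
  longer prefixes.  Such \<open>\<alpha>\<^sub>j\<close> have a common upper bound \<open>\<beta>\<close>, so the preimages are summable in the
  Banach space spanned by \<open>A \<beta>\<close>.  The same bound turns the increments of a Cauchy sequence
  into a sequence converging fast in \<open>F\<close>, and disked hulls of fast convergent sequences are fast
  precompact.
\<close>

section \<open>Multiples of disks\<close>

context hausdorff_lcs
begin

lemma disk_neg:
  assumes "disk sc B" "b \<in> B"
  shows "- b \<in> B"
proof -
  have "sc (of_real (-1)) b \<in> B" by (rule disk_scaleD[OF assms(1) _ assms(2)]) simp
  then show ?thesis by (simp only: sc_of_real) simp
qed

lemma disk_zero: "disk sc B \<Longrightarrow> 0 \<in> B"
  using disk_scaleD[of sc B 0] by (auto simp: disk_def)

lemma disk_mult_mono:
  assumes B: "disk sc B" and st: "0 \<le> s" "s \<le> t"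
  shows "(*\<^sub>R) s ` B \<subseteq> (*\<^sub>R) t ` B"
proof (cases "t = 0")
  case False
  show ?thesis
  proof
    fix x assume "x \<in> (*\<^sub>R) s ` B"
    then obtain b where b: "b \<in> B" "x = s *\<^sub>R b" by auto
    have "sc (of_real (s / t)) b \<in> B"
      by (rule disk_scaleD[OF B _ b(1)]) (use st False in \<open>simp add: norm_divide\<close>)
    then have "(s / t) *\<^sub>R b \<in> B" by (simp only: sc_of_real)
    then have "t *\<^sub>R (s / t) *\<^sub>R b \<in> (*\<^sub>R) t ` B" by (rule imageI)
    then show "x \<in> (*\<^sub>R) t ` B" using b False by simp
  qed
qed (use st in auto)

text \<open>This is the triangle inequality for the gauge of \<open>B\<close>, phrased through
  membership in multiples of \<open>B\<close>. Working with multiples keeps the infimum in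
  \<open>disk_norm\<close> out of all later estimates.\<close>

lemma disk_mult_add:
  assumes B: "disk sc B" and st: "0 \<le> s" "0 \<le> t"
    and x: "x \<in> (*\<^sub>R) s ` B" and y: "y \<in> (*\<^sub>R) t ` B"
  shows "x + y \<in> (*\<^sub>R) (s + t) ` B"
proof (cases "s + t = 0")
  case True
  then have "s = 0" "t = 0" using st by auto
  then show ?thesis using x y by auto
next
  case False
  obtain a b where ab: "a \<in> B" "b \<in> B" "x = s *\<^sub>R a" "y = t *\<^sub>R b" using x y by auto
  have "(s / (s + t)) *\<^sub>R a + (t / (s + t)) *\<^sub>R b \<in> B"
    using B ab st False by (intro convexD) (auto simp: disk_def simp flip: add_divide_distrib)
  then have "(s + t) *\<^sub>R ((s / (s + t)) *\<^sub>R a + (t / (s + t)) *\<^sub>R b) \<in> (*\<^sub>R) (s + t) ` B"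
    by (rule imageI)
  then show ?thesis using ab False by (simp add: scaleR_add_right)
qed

lemma disk_mult_neg: "disk sc B \<Longrightarrow> x \<in> (*\<^sub>R) t ` B \<Longrightarrow> - x \<in> (*\<^sub>R) t ` B"
  using disk_neg by (force simp flip: scaleR_minus_right)

lemma disk_mult_diff:
  assumes "disk sc B" "0 \<le> s" "0 \<le> t" "x \<in> (*\<^sub>R) s ` B" "y \<in> (*\<^sub>R) t ` B"
  shows "x - y \<in> (*\<^sub>R) (s + t) ` B"
  using disk_mult_add[OF assms(1-4) disk_mult_neg[OF assms(1,5)]] by simp

lemma sc_scaleR: "sc c (t *\<^sub>R x) = t *\<^sub>R sc c x"
  by (metis sc_of_real scale_left_commute)

lemma disk_sc_mult:
  assumes B: "disk sc B" and x: "x \<in> (*\<^sub>R) t ` B"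
  shows "sc c x \<in> (*\<^sub>R) (norm c * t) ` B"
proof (cases "c = 0")
  case True
  then show ?thesis using disk_zero[OF B] by (auto simp: image_iff intro!: bexI[of _ 0])
next
  case False
  obtain b where b: "b \<in> B" "x = t *\<^sub>R b" using x by auto
  \<comment> \<open>Split \<open>c\<close> into its absolute value and a scalar of norm 1; the
    latter maps \<open>B\<close> into itself.\<close>
  have "sc (c / of_real (norm c)) b \<in> B"
    by (rule disk_scaleD[OF B _ b(1)]) (use False in \<open>simp add: norm_divide\<close>)
  moreover have "sc c b = norm c *\<^sub>R sc (c / of_real (norm c)) b"
    using False by (simp flip: sc_of_real)
  ultimately show ?thesis using b by (auto simp: sc_scaleR image_iff mult.commute)
qed

lemma disk_mult_subset_span:
  assumes "x \<in> (*\<^sub>R) t ` B"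
  shows "x \<in> span B"
proof -
  obtain b where "b \<in> B" "x = sc (of_real t) b" using assms by (auto simp: sc_of_real)
  then show ?thesis by (simp add: span_base span_scale)
qed

lemma disk_norm_le:
  assumes "x \<in> (*\<^sub>R) t ` B" "t > 0"
  shows "disk_norm sc B x \<le> t"
proof -
  have "Inf {t. 0 < t \<and> x \<in> (\<lambda>b. t *\<^sub>R b) ` B} \<le> t"
    by (rule cInf_lower) (use assms in \<open>auto intro: bdd_belowI[of _ 0]\<close>)
  then show ?thesis using assms disk_mult_subset_span[OF assms(1)] by (simp add: disk_norm_def)
qed

text \<open>The inequality is strict because the infimum defining the gauge need not be attained; a
  multiple slightly above it does contain \<open>x\<close>. Together with
  \<open>disk_norm_le\<close> this translates between the metric and multiples of
  \<open>B\<close>.\<close>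

lemma disk_norm_lessD:
  assumes B: "disk sc B" and x: "x \<in> span B" and less: "disk_norm sc B x < t"
  shows "x \<in> (*\<^sub>R) t ` B"
proof -
  have "{t. 0 < t \<and> x \<in> (\<lambda>b. t *\<^sub>R b) ` B} \<noteq> {}"
    using disk_span_explicit[OF B x] by auto
  then obtain s where "0 < s" "x \<in> (*\<^sub>R) s ` B" "s < t"
    using less x cInf_lessD[of "{t. 0 < t \<and> x \<in> (\<lambda>b. t *\<^sub>R b) ` B}" t]
    by (auto simp: disk_norm_def)
  then show ?thesis using disk_mult_mono[OF B, of s t] by auto
qed

lemma disk_multE:
  assumes "disk sc B" "x \<in> span B"
  obtains t where "t > 0" "x \<in> (*\<^sub>R) t ` B"
  using disk_span_explicit[OF assms] by blast

lemma disk_hull: "disk sc (disk sc hull S)"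
proof (rule hull_in)
  fix \<D> assume D: "\<forall>D\<in>\<D>. disk sc D"
  \<comment> \<open>Nonemptiness is part of \<open>disk\<close>; the common point 0 secures it for
    the intersection.\<close>
  then have "0 \<in> \<Inter>\<D>" using disk_zero by auto
  moreover have "convex (\<Inter>\<D>)" using D by (auto simp: disk_def intro: convex_Inter)
  moreover have "sc c x \<in> \<Inter>\<D>" if "norm c \<le> 1" "x \<in> \<Inter>\<D>" for c x
    using that D disk_scaleD by blast
  ultimately show "disk sc (\<Inter>\<D>)" unfolding disk_def by blast
qed

text \<open>This allows \<open>hull_minimal\<close> to be applied with a subspace, so that disked
  hulls stay inside \<open>H\<close> or inside the span of a disk.\<close>

lemma subspace_imp_disk:
  assumes H: "subspace H"
  shows "disk sc H"
proof -
  have "convex H"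
  proof (rule convexI)
    fix x y and u v :: real assume "x \<in> H" "y \<in> H"
    then have "sc (of_real u) x + sc (of_real v) y \<in> H"
      by (intro subspace_add[OF H] subspace_scale[OF H])
    then show "u *\<^sub>R x + v *\<^sub>R y \<in> H" by (simp only: sc_of_real)
  qed
  then show ?thesis
    using subspace_0[OF H] subspace_scale[OF H] unfolding disk_def by blast
qed

lemma subspace_scaleR: "subspace H \<Longrightarrow> x \<in> H \<Longrightarrow> t *\<^sub>R x \<in> H"
  using subspace_scale[of H x "of_real t"] by (simp add: sc_of_real)

section \<open>Convergence along a bounded disk\<close>

lemma continuous_scaleR: "continuous_on UNIV (\<lambda>x :: 'a. t *\<^sub>R x)"
proof -
  have "continuous_on UNIV (\<lambda>x :: 'a. (\<lambda>(c, x). sc c x) (of_real t, x))"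
    by (rule continuous_on_compose2[OF continuous_sc]) (auto intro!: continuous_intros)
  then show ?thesis by (simp add: sc_of_real)
qed

lemma interior_scaleR:
  fixes S :: "'a set"
  assumes "0 \<in> interior S" "t \<noteq> 0"
  shows "0 \<in> interior ((*\<^sub>R) t ` S)"
proof (rule interiorI)
  let ?U = "(\<lambda>x. inverse t *\<^sub>R x) -` interior S"
  show "open ?U" by (rule open_vimage[OF open_interior continuous_scaleR])
  show "0 \<in> ?U" using assms by simp
  show "?U \<subseteq> (*\<^sub>R) t ` S"
  proof
    fix x assume "x \<in> ?U"
    then have "inverse t *\<^sub>R x \<in> S" using interior_subset by auto
    then have "t *\<^sub>R inverse t *\<^sub>R x \<in> (*\<^sub>R) t ` S" by (rule imageI)
    then show "x \<in> (*\<^sub>R) t ` S" using assms by simp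
  qed
qed

text \<open>A neighbourhood of 0 absorbs the bounded set \<open>B\<close>, hence contains all
  sufficiently small multiples of it. In other words, the norm topology of a bounded disk is finer
  than the ambient one.\<close>

lemma tendsto_zero_bounded:
  assumes bdd: "tvs_bounded sc B"
    and x: "\<And>n. x n \<in> (*\<^sub>R) (\<epsilon> n) ` B" and \<epsilon>: "\<epsilon> \<longlonglongrightarrow> 0"
  shows "x \<longlonglongrightarrow> 0"
proof (rule topological_tendstoI)
  fix U assume "open U" "(0 :: 'a) \<in> U"
  then obtain \<rho> where \<rho>: "\<rho> > 0" "\<And>c. \<rho> \<le> norm c \<Longrightarrow> B \<subseteq> sc c ` U"
    using bdd unfolding tvs_bounded_def absorbs_def by meson
  have "\<forall>\<^sub>F n in sequentially. dist (\<epsilon> n) 0 < 1 / \<rho>"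
    by (rule tendstoD[OF \<epsilon>]) (use \<rho> in simp)
  then show "\<forall>\<^sub>F n in sequentially. x n \<in> U"
  proof (rule eventually_mono)
    fix n assume n: "dist (\<epsilon> n) 0 < 1 / \<rho>"
    obtain b where b: "b \<in> B" "x n = \<epsilon> n *\<^sub>R b" using x[of n] by auto
    show "x n \<in> U"
    proof (cases "\<epsilon> n = 0")
      case False
      \<comment> \<open>The absorbing scalar is \<open>1 / \<epsilon> n\<close>: then
        \<open>B\<close> lies in the corresponding multiple of \<open>U\<close>, which means that
        \<open>\<epsilon> n\<close> times \<open>B\<close> lies in \<open>U\<close>.\<close>
      have "\<rho> \<le> norm (of_real (1 / \<epsilon> n) :: 'k)"
        using n False \<rho>(1) by (simp add: norm_divide field_simps)
      from \<rho>(2)[OF this] b(1) obtain u where u: "u \<in> U" "b = sc (of_real (1 / \<epsilon> n)) u" by auto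
      then have "x n = u" using b False by (simp only: sc_of_real) simp
      with u show ?thesis by simp
    qed (use b \<open>0 \<in> U\<close> in simp)
  qed
qed

lemma limitin_disk_topology:
  assumes B: "disk sc B" "tvs_bounded sc B" and y: "y \<in> span B"
    and x: "\<And>n. x n - y \<in> (*\<^sub>R) (\<epsilon> n) ` B" and \<epsilon>: "\<epsilon> \<longlonglongrightarrow> 0"
  shows "limitin (disk_topology sc B) x y sequentially"
proof -
  interpret Metric_space "span B" "disk_dist sc B" by (rule Metric_space_disk[OF B])
  have span: "x n \<in> span B" for n
    using span_add[OF disk_mult_subset_span[OF x[of n]] y] by simp
  show ?thesis
    unfolding limitin_metric
  proof (intro conjI allI impI y)
    fix e :: real assume e: "e > 0"
    \<comment> \<open>Half of \<open>e\<close>, since \<open>disk_norm_le\<close> yields only a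
      non-strict bound.\<close>
    have "\<forall>\<^sub>F n in sequentially. dist (\<epsilon> n) 0 < e / 2"
      by (rule tendstoD[OF \<epsilon>]) (use e in simp)
    then show "\<forall>\<^sub>F n in sequentially. x n \<in> span B \<and> disk_dist sc B (x n) y < e"
    proof (rule eventually_mono)
      fix n assume n: "dist (\<epsilon> n) 0 < e / 2"
      \<comment> \<open>The sign of \<open>\<epsilon> n\<close> is unrestricted, while
        \<open>disk_mult_mono\<close> speaks of nonnegative factors; symmetry of the disk bridges
        the two.\<close>
      have "(*\<^sub>R) (\<epsilon> n) ` B \<subseteq> (*\<^sub>R) \<bar>\<epsilon> n\<bar> ` B"
      proof
        fix z assume "z \<in> (*\<^sub>R) (\<epsilon> n) ` B"
        then obtain b where "b \<in> B" "z = \<epsilon> n *\<^sub>R b" by auto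
        then show "z \<in> (*\<^sub>R) \<bar>\<epsilon> n\<bar> ` B"
          using disk_neg[OF B(1)] by (cases "\<epsilon> n \<ge> 0") (auto intro: rev_image_eqI[of b] rev_image_eqI[of "- b"])
      qed
      then have "x n - y \<in> (*\<^sub>R) \<bar>\<epsilon> n\<bar> ` B" using x[of n] by blast
      then have "x n - y \<in> (*\<^sub>R) (e / 2) ` B"
        using disk_mult_mono[OF B(1), of "\<bar>\<epsilon> n\<bar>" "e / 2"] n by auto
      from disk_norm_le[OF this] show "x n \<in> span B \<and> disk_dist sc B (x n) y < e"
        using e span by auto
    qed
  qed
qed

lemma fast_closed_limit:
  assumes B: "banach_disk sc B" and H: "fast_closed sc H" and y: "y \<in> span B"
    and x: "\<And>n. x n - y \<in> (*\<^sub>R) (\<epsilon> n) ` B" and \<epsilon>: "\<epsilon> \<longlonglongrightarrow> 0" and xH: "\<And>n. x n \<in> H"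
  shows "y \<in> H"
proof -
  have B': "disk sc B" "tvs_bounded sc B" using B by (auto simp: banach_disk_def)
  have "x n \<in> span B" for n
    using span_add[OF disk_mult_subset_span[OF x[of n]] y] by simp
  then have "y \<in> H \<inter> span B"
    using H B xH limitin_disk_topology[OF B' y x \<epsilon>]
    by (intro limitin_closedin[of "disk_topology sc B" x y sequentially]) (auto simp: fast_closed_def)
  then show ?thesis by simp
qed

text \<open>The partial sums are Cauchy in the Banach space spanned by \<open>B\<close>, with tails
  in \<open>2 * c / 2 ^ n\<close> times \<open>B\<close>. As \<open>B\<close> need not be closed
  there, passing to the limit costs a further \<open>c / 2 ^ n\<close>, whence the factor 3. The
  case \<open>n = 0\<close> is the origin of the 3 in \<open>lift_closure\<close>.\<close>

lemma banach_disk_geometric_sum: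
  assumes B: "banach_disk sc B" and c: "c > 0"
    and u: "\<And>j. u j \<in> (*\<^sub>R) (c / 2 ^ j) ` B"
  obtains s where "\<And>n. s - (\<Sum>j<n. u j) \<in> (*\<^sub>R) (3 * c / 2 ^ n) ` B"
proof -
  have B': "disk sc B" "tvs_bounded sc B" using B by (auto simp: banach_disk_def)
  interpret Metric_space "span B" "disk_dist sc B" by (rule Metric_space_disk[OF B'])
  define S where "S n = (\<Sum>j<n. u j)" for n
  have S_span: "S n \<in> span B" for n
    unfolding S_def by (rule span_sum[OF disk_mult_subset_span[OF u]])
  \<comment> \<open>The factor is the exact finite geometric sum, so the induction on
    \<open>m\<close> closes without loss.\<close>
  have tail': "S (n + m) - S n \<in> (*\<^sub>R) (2 * c / 2 ^ n - 2 * c / 2 ^ (n + m)) ` B" for n m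
  proof (induction m)
    case 0
    then show ?case using disk_zero[OF B'(1)] by (auto simp: image_iff)
  next
    case (Suc m)
    have nonneg: "0 \<le> 2 * c / 2 ^ n - 2 * c / 2 ^ (n + m)"
      using c by (simp add: field_simps power_add)
    have "S (n + m) - S n + u (n + m) \<in>
      (*\<^sub>R) (2 * c / 2 ^ n - 2 * c / 2 ^ (n + m) + c / 2 ^ (n + m)) ` B"
      using c by (intro disk_mult_add[OF B'(1) nonneg _ Suc u]) simp
    moreover have "S (n + m) - S n + u (n + m) = S (n + Suc m) - S n"
      by (simp add: S_def)
    moreover have "2 * c / 2 ^ n - 2 * c / 2 ^ (n + m) + c / 2 ^ (n + m) =
        2 * c / 2 ^ n - 2 * c / 2 ^ (n + Suc m)"
      by (simp add: field_simps)
    ultimately show ?case by metis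
  qed
  have tail: "S m - S n \<in> (*\<^sub>R) (2 * c / 2 ^ n) ` B" if "n \<le> m" for n m
  proof -
    have "0 \<le> 2 * c / 2 ^ n - 2 * c / 2 ^ m"
      using c that by (simp add: field_simps)
    moreover have "2 * c / 2 ^ n - 2 * c / 2 ^ m \<le> 2 * c / 2 ^ n" using c by simp
    ultimately show ?thesis
      using tail'[of n "m - n"] disk_mult_mono[OF B'(1)] le_add_diff_inverse[OF that]
      by (metis subsetD)
  qed
  have "MCauchy S"
    unfolding MCauchy_def
  proof (intro conjI allI impI)
    show "range S \<subseteq> span B" using S_span by auto
    fix e :: real assume e: "e > 0"
    obtain N where N: "2 * c / 2 ^ N < e"
      using real_arch_pow_inv[of "e / (2 * c)" "1/2"] e c by (auto simp: field_simps)
    have "disk_dist sc B (S m) (S n) < e" if "N \<le> n" "n \<le> m" for n m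
    proof -
      have "disk_dist sc B (S m) (S n) \<le> 2 * c / 2 ^ n"
        by (rule disk_norm_le[OF tail[OF that(2)]]) (use c in simp)
      also have "\<dots> \<le> 2 * c / 2 ^ N"
        using c that by (simp add: field_simps)
      finally show ?thesis using N by simp
    qed
    then show "\<exists>N. \<forall>n n'. N \<le> n \<longrightarrow> N \<le> n' \<longrightarrow> disk_dist sc B (S n) (S n') < e"
      by (metis commute nle_le)
  qed
  then obtain s where s: "limitin mtopology S s sequentially"
    using B unfolding banach_disk_def mcomplete_def by blast
  have "s - S n \<in> (*\<^sub>R) (3 * c / 2 ^ n) ` B" for n
  proof -
    have "\<exists>N. \<forall>m\<ge>N. S m \<in> span B \<and> disk_dist sc B (S m) s < c / 2 ^ n"
      using s c unfolding limit_metric_sequentially by simp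
    then obtain N where N: "\<And>m. m \<ge> N \<Longrightarrow> disk_dist sc B (S m) s < c / 2 ^ n" by auto
    define m where "m = max n N"
    have "S m - s \<in> (*\<^sub>R) (c / 2 ^ n) ` B"
      using s S_span by (intro disk_norm_lessD[OF B'(1)] N span_diff) (auto simp: m_def limitin_metric)
    then have "(S m - S n) - (S m - s) \<in> (*\<^sub>R) (2 * c / 2 ^ n + c / 2 ^ n) ` B"
      using c tail[of n m] by (intro disk_mult_diff[OF B'(1)]) (auto simp: m_def)
    then show ?thesis by (simp add: field_simps)
  qed
  then show ?thesis using that unfolding S_def by blast
qed

end

section \<open>Disked hulls of fast convergent sequences\<close>

text \<open>By the two alternatives of \<open>real_or_complex\<close>, the closed unit ball lies in
  a continuous image of an interval or of a square. Such an image is compact, hence totally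
  bounded.\<close>

lemma unit_ball_finite_net:
  assumes "e > 0"
  shows "\<exists>C. finite C \<and> (\<forall>c :: 'k::real_or_complex. norm c \<le> 1 \<longrightarrow> (\<exists>d\<in>C. norm (c - d) < e))"
proof -
  have "\<exists>K. compact K \<and> cball (0 :: 'k) 1 \<subseteq> K"
    using real_or_complex[where 'a = 'k]
  proof (elim disjE exE conjE)
    assume R: "\<forall>z :: 'k. \<exists>a. z = a *\<^sub>R 1"
    have "cball (0 :: 'k) 1 \<subseteq> (\<lambda>a. a *\<^sub>R 1) ` {-1..1}"
    proof
      fix z :: 'k assume z: "z \<in> cball 0 1"
      obtain a where "z = a *\<^sub>R 1" using R by blast
      then show "z \<in> (\<lambda>a. a *\<^sub>R 1) ` {-1..1}" using z by (auto simp: abs_le_iff)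
    qed
    moreover have "compact ((\<lambda>a. a *\<^sub>R 1 :: 'k) ` {-1..1})"
      by (intro compact_continuous_image continuous_intros compact_Icc)
    ultimately show ?thesis by blast
  next
    fix i :: 'k
    assume C: "\<forall>z :: 'k. \<exists>a b. z = a *\<^sub>R 1 + b *\<^sub>R i \<and> norm z = sqrt (a\<^sup>2 + b\<^sup>2)"
    let ?f = "\<lambda>(a, b). a *\<^sub>R 1 + b *\<^sub>R i"
    have "cball (0 :: 'k) 1 \<subseteq> ?f ` ({-1..1} \<times> {-1..1})"
    proof
      fix z :: 'k assume z: "z \<in> cball 0 1"
      obtain a b where ab: "z = a *\<^sub>R 1 + b *\<^sub>R i" "norm z = sqrt (a\<^sup>2 + b\<^sup>2)"
        using C by blast
      then have "\<bar>a\<bar> \<le> 1" "\<bar>b\<bar> \<le> 1"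
        using z real_sqrt_sum_squares_ge1[of a b] real_sqrt_sum_squares_ge2[of b a]
          abs_le_square_iff[of a 1] abs_le_square_iff[of b 1] zero_le_power2[of a] zero_le_power2[of b]
        by (auto simp del: zero_le_power2)
      then show "z \<in> ?f ` ({-1..1} \<times> {-1..1})" using ab by (auto simp: abs_le_iff)
    qed
    moreover have "compact (?f ` ({-1..1} \<times> {-1..1}))"
      unfolding case_prod_beta
      by (intro compact_continuous_image continuous_intros compact_Times compact_Icc)
    ultimately show ?thesis by blast
  qed
  then obtain K where K: "compact K" "cball (0 :: 'k) 1 \<subseteq> K" by blast
  obtain C where "finite C" "K \<subseteq> (\<Union>x\<in>C. ball x e)"
    using K(1) assms unfolding compact_eq_totally_bounded by blast
  then show ?thesis
    using K(2) by (intro exI[of _ C]) (fastforce simp: dist_norm norm_minus_commute subset_iff)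
qed

context hausdorff_lcs
begin

lemma disk_plus:
  assumes "disk sc A" "disk sc B"
  shows "disk sc {a + b | a b. a \<in> A \<and> b \<in> B}"
proof -
  have eq: "{a + b | a b. a \<in> A \<and> b \<in> B} = (\<Union>a\<in>A. \<Union>b\<in>B. {a + b})" by auto
  have "convex {a + b | a b. a \<in> A \<and> b \<in> B}"
    unfolding eq by (rule convex_sums) (use assms in \<open>auto simp: disk_def\<close>)
  moreover have "sc c ` {a + b | a b. a \<in> A \<and> b \<in> B} \<subseteq> {a + b | a b. a \<in> A \<and> b \<in> B}"
    if "norm c \<le> 1" for c
    using disk_scaleD[OF assms(1) that] disk_scaleD[OF assms(2) that]
    by (auto simp: scale_right_distrib) blast
  ultimately show ?thesis
    using disk_zero[OF assms(1)] disk_zero[OF assms(2)] unfolding disk_def by blast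
qed

lemma disk_mult:
  assumes "disk sc B"
  shows "disk sc ((*\<^sub>R) t ` B)"
proof -
  have "convex ((*\<^sub>R) t ` B)" using assms by (auto simp: disk_def intro: convex_scaling)
  moreover have "sc c ` (*\<^sub>R) t ` B \<subseteq> (*\<^sub>R) t ` B" if "norm c \<le> 1" for c
    using disk_scaleD[OF assms that] by (auto simp: sc_scaleR)
  ultimately show ?thesis using assms unfolding disk_def by blast
qed

lemma disk_orbit: "disk sc ((\<lambda>c. sc c x) ` cball 0 1)"
proof -
  have "convex ((\<lambda>c. sc c x) ` cball 0 1)"
  proof (rule convexI)
    fix y z and u v :: real
    assume yz: "y \<in> (\<lambda>c. sc c x) ` cball 0 1" "z \<in> (\<lambda>c. sc c x) ` cball 0 1"
      and uv: "0 \<le> u" "0 \<le> v" "u + v = 1"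
    obtain c d where cd: "norm c \<le> 1" "norm d \<le> 1" "y = sc c x" "z = sc d x" using yz by auto
    have "u *\<^sub>R c + v *\<^sub>R d \<in> cball 0 1" using cd uv by (intro convexD[OF convex_cball]) auto
    moreover have "u *\<^sub>R y + v *\<^sub>R z = sc (u *\<^sub>R c + v *\<^sub>R d) x"
      by (simp add: cd scale_left_distrib scaleR_conv_of_real flip: sc_of_real)
    ultimately show "u *\<^sub>R y + v *\<^sub>R z \<in> (\<lambda>c. sc c x) ` cball 0 1" by blast
  qed
  moreover have "sc d ` (\<lambda>c. sc c x) ` cball 0 1 \<subseteq> (\<lambda>c. sc c x) ` cball 0 1" if "norm d \<le> 1" for d
    using that by (auto simp: norm_mult intro!: imageI mult_le_one)
  ultimately show ?thesis unfolding disk_def by (auto intro: exI[of _ 0])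
qed

text \<open>Points are added one at a time: to a precompact disk \<open>D\<close> the orbit of the
  new point \<open>x\<close> under the unit ball of scalars is added, and a net arises by adding to
  a net of \<open>D\<close> the multiples of \<open>x\<close> by a net of scalars.\<close>

lemma finite_subset_precompact_disk:
  assumes B: "disk sc B" and "finite X" "X \<subseteq> span B"
  shows "\<exists>D. disk sc D \<and> X \<subseteq> D \<and> (\<forall>e>0. \<exists>K. finite K \<and> (\<forall>x\<in>D. \<exists>k\<in>K. x - k \<in> (*\<^sub>R) e ` B))"
  using assms(2,3)
proof (induction X rule: finite_induct)
  case empty
  have "disk sc {0}" unfolding disk_def by auto
  moreover have "0 \<in> (*\<^sub>R) e ` B" for e using disk_zero[OF B] by (auto simp: image_iff)
  ultimately show ?case by (intro exI[of _ "{0}"]) (auto intro!: exI[of _ "{0}"])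
next
  case (insert x X)
  then obtain D where D: "disk sc D" "X \<subseteq> D"
    "\<And>e. e > 0 \<Longrightarrow> \<exists>K. finite K \<and> (\<forall>x\<in>D. \<exists>k\<in>K. x - k \<in> (*\<^sub>R) e ` B)" by blast
  obtain t where t: "t > 0" "x \<in> (*\<^sub>R) t ` B" using disk_multE[OF B, of x] insert.prems by auto
  define O' where "O' = (\<lambda>c. sc c x) ` cball 0 1"
  have O': "disk sc O'" unfolding O'_def by (rule disk_orbit)
  define D' where "D' = {a + b | a b. a \<in> D \<and> b \<in> O'}"
  have "disk sc D'" unfolding D'_def by (rule disk_plus[OF D(1) O'])
  moreover have "insert x X \<subseteq> D'"
  proof -
    have "sc 1 x \<in> O'" unfolding O'_def by (rule imageI) simp
    then have "0 + x \<in> D'" using disk_zero[OF D(1)] unfolding D'_def by fastforce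
    moreover have "a + 0 \<in> D'" if "a \<in> X" for a
      using that D(2) disk_zero[OF O'] unfolding D'_def by blast
    ultimately show ?thesis by auto
  qed
  moreover have "\<exists>K. finite K \<and> (\<forall>y\<in>D'. \<exists>k\<in>K. y - k \<in> (*\<^sub>R) e ` B)" if e: "e > 0" for e
  proof -
    obtain K where K: "finite K" "\<And>a. a \<in> D \<Longrightarrow> \<exists>k\<in>K. a - k \<in> (*\<^sub>R) (e / 2) ` B"
      using D(3)[of "e / 2"] e by auto
    \<comment> \<open>Since \<open>x\<close> lies in \<open>t\<close> times \<open>B\<close>,
      scalars closer than \<open>e / (2 * t)\<close> move \<open>x\<close> by at most
      \<open>e / 2\<close>; the other half of \<open>e\<close> is spent on \<open>D\<close>.\<close>
    obtain C where C: "finite C" "\<And>c :: 'k. norm c \<le> 1 \<Longrightarrow> \<exists>d\<in>C. norm (c - d) < e / (2 * t)"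
      using unit_ball_finite_net[of "e / (2 * t)", where 'k = 'k] e t by auto
    let ?K = "(\<lambda>(k, d). k + sc d x) ` (K \<times> C)"
    have "\<exists>k\<in>?K. y - k \<in> (*\<^sub>R) e ` B" if y: "y \<in> D'" for y
    proof -
      obtain a c where ac: "a \<in> D" "norm c \<le> 1" "y = a + sc c x"
        using y unfolding D'_def O'_def by (auto simp: mem_cball_0)
      obtain k d where kd: "k \<in> K" "a - k \<in> (*\<^sub>R) (e / 2) ` B" "d \<in> C" "norm (c - d) < e / (2 * t)"
        using K(2)[OF ac(1)] C(2)[OF ac(2)] by blast
      have "norm (c - d) * t \<le> e / 2" using kd(4) t by (simp add: field_simps)
      then have "sc (c - d) x \<in> (*\<^sub>R) (e / 2) ` B"
        using disk_sc_mult[OF B t(2), of "c - d"] disk_mult_mono[OF B, of "norm (c - d) * t" "e / 2"] t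
        by auto
      then have "(a - k) + sc (c - d) x \<in> (*\<^sub>R) (e / 2 + e / 2) ` B"
        using e kd(2) by (intro disk_mult_add[OF B]) auto
      then have "y - (k + sc d x) \<in> (*\<^sub>R) e ` B"
        by (simp add: ac scale_left_diff_distrib algebra_simps)
      then show ?thesis using kd by force
    qed
    then show ?thesis using K(1) C(1) by (intro exI[of _ ?K]) auto
  qed
  ultimately show ?case by blast
qed

text \<open>Up to a small multiple of \<open>B\<close>, the sequence consists of finitely many
  points and its limit. These lie in a precompact disk \<open>D\<close>, and the sum of
  \<open>D\<close> and that multiple is again a disk, so it contains the whole hull.\<close>

lemma mtotally_bounded_disk_hull:
  assumes B: "disk sc B" "tvs_bounded sc B" and u: "range u \<subseteq> span B"
    and lim: "limitin (disk_topology sc B) u y sequentially"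
  shows "Metric_space.mtotally_bounded (span B) (disk_dist sc B) (disk sc hull range u)"
proof -
  interpret Metric_space "span B" "disk_dist sc B" by (rule Metric_space_disk[OF B])
  let ?S = "disk sc hull range u"
  have S_span: "?S \<subseteq> span B"
    by (intro hull_minimal u subspace_imp_disk subspace_span)
  have y: "y \<in> span B" using lim by (simp add: limitin_metric)
  have "\<exists>P. finite P \<and> P \<subseteq> ?S \<and> ?S \<subseteq> (\<Union>x\<in>P. mball x e)" if "e > 0" for e
  proof -
    \<comment> \<open>The approximation by \<open>D\<close> and the net of \<open>D\<close> cost
      \<open>\<delta>\<close> each, and recentring doubles the sum to \<open>4 * \<delta>\<close>,
      which is below \<open>e\<close>.\<close>
    define \<delta> where "\<delta> = e / 8"
    have \<delta>: "\<delta> > 0" using that by (simp add: \<delta>_def)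
    obtain N where N: "\<And>n. n \<ge> N \<Longrightarrow> disk_dist sc B (u n) y < \<delta>"
      using lim \<delta> unfolding limit_metric_sequentially by blast
    have tail: "u n - y \<in> (*\<^sub>R) \<delta> ` B" if "n \<ge> N" for n
      using u y by (intro disk_norm_lessD[OF B(1)] N that span_diff) auto
    have "insert y (u ` {..<N}) \<subseteq> span B" using u y by auto
    then obtain D where D: "disk sc D" "insert y (u ` {..<N}) \<subseteq> D"
      "\<And>e. e > 0 \<Longrightarrow> \<exists>K. finite K \<and> (\<forall>x\<in>D. \<exists>k\<in>K. x - k \<in> (*\<^sub>R) e ` B)"
      using finite_subset_precompact_disk[OF B(1), of "insert y (u ` {..<N})"] by blast
    obtain K where K: "finite K" "\<And>x. x \<in> D \<Longrightarrow> \<exists>k\<in>K. x - k \<in> (*\<^sub>R) \<delta> ` B"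
      using D(3)[OF \<delta>] by blast
    have "u n \<in> {a + b | a b. a \<in> D \<and> b \<in> (*\<^sub>R) \<delta> ` B}" for n
    proof (cases "n < N")
      case True
      then have "u n + 0 \<in> {a + b | a b. a \<in> D \<and> b \<in> (*\<^sub>R) \<delta> ` B}"
        using D(2) disk_zero[OF disk_mult[OF B(1)]] by blast
      then show ?thesis by simp
    next
      case False
      then have "y + (u n - y) \<in> {a + b | a b. a \<in> D \<and> b \<in> (*\<^sub>R) \<delta> ` B}"
        using D(2) tail[of n] by (intro CollectI exI conjI) auto
      then show ?thesis by simp
    qed
    then have S: "?S \<subseteq> {a + b | a b. a \<in> D \<and> b \<in> (*\<^sub>R) \<delta> ` B}"
      by (intro hull_minimal disk_plus D(1) disk_mult B(1)) auto
    have net: "\<exists>k\<in>K. x - k \<in> (*\<^sub>R) (2 * \<delta>) ` B" if x: "x \<in> ?S" for x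
    proof -
      obtain a b where ab: "x = a + b" "a \<in> D" "b \<in> (*\<^sub>R) \<delta> ` B" using S x by blast
      obtain k where k: "k \<in> K" "a - k \<in> (*\<^sub>R) \<delta> ` B" using K(2)[OF ab(2)] by blast
      have "(a - k) + b \<in> (*\<^sub>R) (\<delta> + \<delta>) ` B"
        using \<delta> k ab by (intro disk_mult_add[OF B(1)]) auto
      then show ?thesis using k ab by (auto simp: algebra_simps)
    qed
    \<comment> \<open>The net \<open>K\<close> need not lie in the hull, but total boundedness asks
      for centres there. Each useful \<open>k\<close> is therefore replaced by a nearby point of the
      hull.\<close>
    define p where "p k = (SOME x. x \<in> ?S \<and> x - k \<in> (*\<^sub>R) (2 * \<delta>) ` B)" for k
    define K' where "K' = {k \<in> K. \<exists>x. x \<in> ?S \<and> x - k \<in> (*\<^sub>R) (2 * \<delta>) ` B}"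
    have p: "p k \<in> ?S \<and> p k - k \<in> (*\<^sub>R) (2 * \<delta>) ` B" if "k \<in> K'" for k
      using that unfolding p_def K'_def by (metis (mono_tags, lifting) mem_Collect_eq someI_ex)
    have "x \<in> (\<Union>z\<in>p ` K'. mball z e)" if x: "x \<in> ?S" for x
    proof -
      obtain k where k: "k \<in> K'" "x - k \<in> (*\<^sub>R) (2 * \<delta>) ` B"
        using net[OF x] x unfolding K'_def by blast
      have "(p k - k) - (x - k) \<in> (*\<^sub>R) (2 * \<delta> + 2 * \<delta>) ` B"
        using \<delta> p[OF k(1)] k by (intro disk_mult_diff[OF B(1)]) auto
      then have "disk_dist sc B (p k) x \<le> 2 * \<delta> + 2 * \<delta>"
        using \<delta> by (intro disk_norm_le) auto
      then have "x \<in> mball (p k) e"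
        using p[OF k(1)] x S_span that \<open>e > 0\<close> by (auto simp: \<delta>_def)
      then show ?thesis using k by blast
    qed
    then show ?thesis
      using K(1) p by (intro exI[of _ "p ` K'"]) (auto simp: K'_def)
  qed
  then show ?thesis unfolding mtotally_bounded_def by blast
qed

end

section \<open>The lifting argument\<close>

text \<open>Each coordinate takes only finitely many values, so the coordinatewise maximum exists.
  The second conclusion keeps a prefix shared by all \<open>\<alpha> n\<close>; without it, the lift
  of a closure point would lose its prefix.\<close>

lemma eventually_fixed_upper_bound:
  fixes \<alpha> :: "nat \<Rightarrow> nat \<Rightarrow> nat"
  assumes "\<And>i. \<forall>\<^sub>F n in sequentially. \<alpha> n i = r i"
  obtains \<beta> where "\<And>n. \<alpha> n \<le> \<beta>" "\<And>i. (\<And>n. \<alpha> n i = r i) \<Longrightarrow> \<beta> i = r i"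
proof
  define \<beta> where "\<beta> i = Max (range (\<lambda>n. \<alpha> n i))" for i
  have fin: "finite (range (\<lambda>n. \<alpha> n i))" for i
  proof -
    obtain M where M: "\<And>n. n \<ge> M \<Longrightarrow> \<alpha> n i = r i"
      using assms[of i] by (auto simp: eventually_sequentially)
    have "\<alpha> n i \<in> insert (r i) ((\<lambda>n. \<alpha> n i) ` {..<M})" for n using M[of n] by (cases "n < M") auto
    then have "range (\<lambda>n. \<alpha> n i) \<subseteq> insert (r i) ((\<lambda>n. \<alpha> n i) ` {..<M})" by auto
    then show ?thesis by (rule finite_subset) simp
  qed
  show "\<alpha> n \<le> \<beta>" for n
    unfolding le_fun_def \<beta>_def using fin by (auto intro: Max_ge)
  show "\<beta> i = r i" if "\<And>n. \<alpha> n i = r i" for i using that by (simp add: \<beta>_def)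
qed

lemma Cauchy_diff_in_nhd:
  fixes y :: "nat \<Rightarrow> 'a::{uniform_topological_group_add, topological_ab_group_add}"
  assumes "Cauchy y" "open U" "0 \<in> U"
  shows "\<exists>N. \<forall>n\<ge>N. \<forall>m\<ge>N. y m - y n \<in> U"
proof -
  have "\<forall>\<^sub>F p in uniformity. (\<lambda>(a, b). b - a :: 'a) p \<in> U"
    unfolding cauchy_seq_finset_iff_vanishing eventually_filtercomap
    using assms(2,3) by (intro exI[of _ "\<lambda>x. x \<in> U"]) (auto intro: eventually_nhds_in_open)
  then show ?thesis using assms(1) unfolding Cauchy_uniform_iff by fastforce
qed

text \<open>\<open>T\<close> is a total function, but its linearity and graph are stated on
  \<open>H\<close> alone, so its values outside \<open>H\<close> are arbitrary. The sequence
  \<open>r\<close> is fixed once for all levels.\<close>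

locale quasi_LB_surjection = E: hausdorff_lcs scaleE + F: hausdorff_lcs scaleF
  for scaleE :: "'k::real_or_complex \<Rightarrow> 'e \<Rightarrow>
      'e::{real_vector, topological_ab_group_add, uniform_topological_group_add, t2_space}"
    and scaleF :: "'k \<Rightarrow> 'f \<Rightarrow>
      'f::{real_vector, topological_ab_group_add, uniform_topological_group_add, t2_space}" +
  fixes A :: "(nat \<Rightarrow> nat) \<Rightarrow> 'f set" and H :: "'f set" and T :: "'f \<Rightarrow> 'e" and r :: "nat \<Rightarrow> nat"
  assumes A: "quasi_LB_representation scaleF A"
    and H_subspace: "F.subspace H"
    and H_closed: "fast_closed scaleF H"
    and T_add: "\<And>x y. \<lbrakk>x \<in> H; y \<in> H\<rbrakk> \<Longrightarrow> T (x + y) = T x + T y"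
    and T_scale: "\<And>c x. x \<in> H \<Longrightarrow> T (scaleF c x) = scaleE c (T x)"
    and T_surj: "T ` H = UNIV"
    and T_graph: "closedin (top_of_set (H \<times> UNIV)) ((\<lambda>x. (x, T x)) ` H)"
    and prefix_image_nhd:
      "\<And>k. k \<ge> 1 \<Longrightarrow> 0 \<in> interior (closure (prefix_image T H A (map r [0..<k])))"
begin

lemma A_banach: "banach_disk scaleF (A \<alpha>)"
  using A by (simp add: quasi_LB_representation_def)

lemma A_disk: "disk scaleF (A \<alpha>)" and A_bounded: "tvs_bounded scaleF (A \<alpha>)"
  using A_banach by (auto simp: banach_disk_def)

lemma A_mult_mono:
  assumes "0 \<le> s" "s \<le> t" "\<alpha> \<le> \<beta>" "x \<in> (*\<^sub>R) s ` A \<alpha>"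
  shows "x \<in> (*\<^sub>R) t ` A \<beta>"
proof -
  have "A \<alpha> \<subseteq> A \<beta>" using A assms(3) by (simp add: quasi_LB_representation_def)
  then show ?thesis using F.disk_mult_mono[OF A_disk assms(1,2)] assms(4) by blast
qed

lemma T_scaleR: "x \<in> H \<Longrightarrow> T (t *\<^sub>R x) = t *\<^sub>R T x"
  using T_scale[of x "of_real t"] by (simp add: E.sc_of_real F.sc_of_real)

lemma T_sum:
  fixes u :: "nat \<Rightarrow> 'f"
  assumes "\<And>j. u j \<in> H"
  shows "T (\<Sum>j<n. u j) = (\<Sum>j<n. T (u j))"
proof (induction n)
  case 0
  show ?case using T_scaleR[of 0 0] F.subspace_0[OF H_subspace] by simp
next
  case (Suc n)
  moreover have "(\<Sum>j<n. u j) \<in> H" by (rule F.subspace_sum[OF H_subspace assms])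
  ultimately show ?case using T_add assms by simp
qed

section \<open>Lifting points of closures\<close>

lemma lift_approximately:
  assumes y: "y \<in> (*\<^sub>R) t ` closure (prefix_image T H A (map r [0..<k]))"
    and U: "open U" "0 \<in> U"
  obtains \<alpha> u where "\<And>i. i < k \<Longrightarrow> \<alpha> i = r i" "u \<in> H" "u \<in> (*\<^sub>R) t ` A \<alpha>" "y - T u \<in> U"
proof -
  let ?V = "prefix_image T H A (map r [0..<k])"
  obtain c where c: "c \<in> closure ?V" "y = t *\<^sub>R c" using y by auto
  \<comment> \<open>Pulling \<open>U\<close> back to a neighbourhood of \<open>c\<close> avoids
    dividing by \<open>t\<close>, which may be 0.\<close>
  define W where "W = (\<lambda>v. y - t *\<^sub>R v) -` U"
  have "open W"
    unfolding W_def by (intro open_vimage U continuous_intros E.continuous_scaleR)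
  moreover have "c \<in> W" using c U by (simp add: W_def)
  ultimately have "W \<inter> ?V \<noteq> {}" using c(1) open_Int_closure_eq_empty[of W ?V] by blast
  then obtain \<alpha> a where a: "\<forall>i<k. \<alpha> i = r i" "a \<in> A \<alpha>" "a \<in> H" "T a \<in> W"
    by (auto simp: prefix_image_def)
  show ?thesis
  proof (rule that[of \<alpha> "t *\<^sub>R a"])
    show "y - T (t *\<^sub>R a) \<in> U" using a by (simp add: W_def T_scaleR)
  qed (use a F.subspace_scaleR[OF H_subspace] in auto)
qed

text \<open>The remainders of the series for \<open>y\<close> need not tend to \<open>0\<close> in \<open>E\<close>.  They still lie in small
  multiples of the closures, so modulo any neighbourhood of \<open>0\<close> they are images of a null
  sequence of \<open>F\<close>; this is all that closedness of the graph requires.\<close>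

lemma lift_closure:
  assumes k: "k \<ge> 1" and y: "y \<in> closure (prefix_image T H A (map r [0..<k]))"
  obtains \<alpha> u where "\<And>i. i < k \<Longrightarrow> \<alpha> i = r i" "u \<in> H" "u \<in> (*\<^sub>R) 3 ` A \<alpha>" "T u = y"
proof -
  \<comment> \<open>The factor shrinks while the prefix grows: the former makes the lifted series
    summable, the latter gives its indices a common upper bound.\<close>
  define C where "C j = (*\<^sub>R) (1 / 2 ^ j) ` closure (prefix_image T H A (map r [0..<k + j]))" for j
  have C_nhd: "0 \<in> interior (C j)" for j
    unfolding C_def using k by (intro E.interior_scaleR prefix_image_nhd) auto
  define Q where "Q j z z' \<longleftrightarrow> (\<exists>\<alpha> u. (\<forall>i<k + j. \<alpha> i = r i) \<and> u \<in> H \<and>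
      u \<in> (*\<^sub>R) (1 / 2 ^ j) ` A \<alpha> \<and> z' = z - T u)" for j z z'
  have "\<exists>z. \<forall>j. (z j \<in> C j \<and> (j = 0 \<longrightarrow> z j = y)) \<and> Q j (z j) (z (Suc j))"
  proof (rule dependent_nat_choice)
    show "\<exists>z. z \<in> C 0 \<and> (0 = (0::nat) \<longrightarrow> z = y)" using y by (auto simp: C_def)
    fix z j assume "z \<in> C j \<and> (j = 0 \<longrightarrow> z = y)"
    then have "z \<in> (*\<^sub>R) (1 / 2 ^ j) ` closure (prefix_image T H A (map r [0..<k + j]))"
      unfolding C_def by blast
    \<comment> \<open>Since \<open>C (Suc j)\<close> is a neighbourhood of 0, the approximation
      error can be forced into it and the construction continues.\<close>
    from lift_approximately[OF this open_interior C_nhd[of "Suc j"]]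
    obtain \<alpha> u where "\<And>i. i < k + j \<Longrightarrow> \<alpha> i = r i" "u \<in> H" "u \<in> (*\<^sub>R) (1 / 2 ^ j) ` A \<alpha>"
      "z - T u \<in> interior (C (Suc j))" by blast
    then show "\<exists>z'. (z' \<in> C (Suc j) \<and> (Suc j = 0 \<longrightarrow> z' = y)) \<and> Q j z z'"
      using interior_subset[of "C (Suc j)"] unfolding Q_def by blast
  qed
  then obtain z where z: "z 0 = y" "\<And>j. z j \<in> C j" "\<And>j. Q j (z j) (z (Suc j))" by blast
  obtain \<alpha> u where \<alpha>: "\<And>i j. i < k + j \<Longrightarrow> \<alpha> j i = r i"
    and u: "\<And>j. u j \<in> H" "\<And>j. u j \<in> (*\<^sub>R) (1 / 2 ^ j) ` A (\<alpha> j)"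
      "\<And>j. z (Suc j) = z j - T (u j)"
    using z(3) unfolding Q_def by metis
  have "\<forall>\<^sub>F j in sequentially. \<alpha> j i = r i" for i
    using \<alpha> by (auto simp: eventually_sequentially intro!: exI[of _ "Suc i"])
  then obtain \<beta> where \<beta>: "\<And>j. \<alpha> j \<le> \<beta>" "\<And>i. (\<And>j. \<alpha> j i = r i) \<Longrightarrow> \<beta> i = r i"
    using eventually_fixed_upper_bound[of \<alpha> r] by blast
  have u\<beta>: "u j \<in> (*\<^sub>R) (1 / 2 ^ j) ` A \<beta>" for j
    by (rule A_mult_mono[OF _ _ \<beta>(1) u(2)]) auto
  obtain s where s: "\<And>n. s - (\<Sum>j<n. u j) \<in> (*\<^sub>R) (3 * 1 / 2 ^ n) ` A \<beta>"
    using F.banach_disk_geometric_sum[OF A_banach zero_less_one u\<beta>] by blast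
  have S_H: "(\<Sum>j<n. u j) \<in> H" for n by (rule F.subspace_sum[OF H_subspace u(1)])
  have s3: "s \<in> (*\<^sub>R) 3 ` A \<beta>" using s[of 0] by simp
  have lim0: "(\<lambda>n. c / 2 ^ n) \<longlonglongrightarrow> 0" for c :: real
    using LIMSEQ_divide_realpow_zero[of 2 c] by simp
  \<comment> \<open>All partial sums lie in \<open>H\<close> and converge to \<open>s\<close> in the
    Banach space of \<open>A \<beta>\<close>, so fast closedness applies.\<close>
  have s_H: "s \<in> H"
  proof (rule F.fast_closed_limit[OF A_banach H_closed _ _ lim0 S_H])
    show "s \<in> F.span (A \<beta>)" by (rule F.disk_mult_subset_span[OF s3])
    show "(\<Sum>j<n. u j) - s \<in> (*\<^sub>R) (3 / 2 ^ n) ` A \<beta>" for n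
      using F.disk_mult_neg[OF A_disk s[of n]] by simp
  qed
  have T_S: "T (\<Sum>j<n. u j) = y - z n" for n
  proof -
    have "T (\<Sum>j<n. u j) = (\<Sum>j<n. z j - z (Suc j))"
      unfolding T_sum[OF u(1)] by (intro sum.cong) (auto simp: u(3))
    then show ?thesis by (simp add: sum_lessThan_telescope' z(1))
  qed
  obtain G where G: "closed G" "(\<lambda>x. (x, T x)) ` H = (H \<times> UNIV) \<inter> G"
    using T_graph unfolding closedin_closed by blast
  have "(s, y) \<in> G"
  proof (rule ccontr)
    assume "(s, y) \<notin> G"
    then have "(s, y) \<in> - G" by simp
    then obtain P U where PU: "open P" "open U" "s \<in> P" "y \<in> U" "P \<times> U \<subseteq> - G"
      by (rule open_prod_elim[OF open_Compl[OF G(1)]]) blast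
    define U0 where "U0 = (\<lambda>z. y - z) -` U"
    have U0: "open U0" "0 \<in> U0"
      unfolding U0_def using PU by (auto intro!: open_vimage continuous_intros)
    \<comment> \<open>The neighbourhood \<open>U0\<close> is now fixed, unlike in the construction
      of \<open>z\<close>. The indices again agree with \<open>r\<close> on growing prefixes, so a
      common bound makes \<open>h\<close> a null sequence in \<open>F\<close>.\<close>
    have "\<exists>\<gamma> h. (\<forall>i<k + n. \<gamma> i = r i) \<and> h \<in> H \<and> h \<in> (*\<^sub>R) (1 / 2 ^ n) ` A \<gamma> \<and> z n - T h \<in> U0" for n
      using lift_approximately[OF z(2)[of n, unfolded C_def] U0] by metis
    then obtain \<gamma> h where \<gamma>: "\<And>n i. i < k + n \<Longrightarrow> \<gamma> n i = r i"
      and h: "\<And>n. h n \<in> H" "\<And>n. h n \<in> (*\<^sub>R) (1 / 2 ^ n) ` A (\<gamma> n)" "\<And>n. z n - T (h n) \<in> U0"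
      by metis
    have "\<forall>\<^sub>F n in sequentially. \<gamma> n i = r i" for i
      using \<gamma> by (auto simp: eventually_sequentially intro!: exI[of _ "Suc i"])
    then obtain \<gamma>' where \<gamma>': "\<And>n. \<gamma> n \<le> \<gamma>'"
      using eventually_fixed_upper_bound[of \<gamma> r] by blast
    have "h \<longlonglongrightarrow> 0"
      by (rule F.tendsto_zero_bounded[OF A_bounded[of \<gamma>'] _ lim0[of 1]], rule A_mult_mono[OF _ _ \<gamma>' h(2)]) auto
    moreover have "(\<lambda>n. s - (\<Sum>j<n. u j)) \<longlonglongrightarrow> 0"
      by (rule F.tendsto_zero_bounded[OF A_bounded[of \<beta>] _ lim0[of 3]]) (use s in simp)
    ultimately have "(\<lambda>n. s - ((s - (\<Sum>j<n. u j)) - h n)) \<longlonglongrightarrow> s - (0 - 0)"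
      by (intro tendsto_diff tendsto_const)
    then have "(\<lambda>n. (\<Sum>j<n. u j) + h n) \<longlonglongrightarrow> s" by (simp add: add.commute)
    then have "\<forall>\<^sub>F n in sequentially. (\<Sum>j<n. u j) + h n \<in> P"
      using PU by (simp add: topological_tendstoD)
    then obtain n where n: "(\<Sum>j<n. u j) + h n \<in> P" by (auto simp: eventually_sequentially)
    \<comment> \<open>The correction \<open>h n\<close> cancels the remainder up to
      \<open>U0\<close>: the image is in \<open>U\<close> for every \<open>n\<close>, while the
      argument enters \<open>P\<close> for large \<open>n\<close>. This puts a point of the graph
      into the box \<open>P \<times> U\<close>.\<close>
    have "T ((\<Sum>j<n. u j) + h n) = y - (z n - T (h n))"
      using T_add[OF S_H h(1)] T_S by simp
    then have "T ((\<Sum>j<n. u j) + h n) \<in> U" using h(3)[of n] by (simp add: U0_def)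
    moreover have "(\<Sum>j<n. u j) + h n \<in> H" using F.subspace_add[OF H_subspace S_H h(1)] .
    ultimately show False using PU(5) n G(2) by blast
  qed
  then have "(s, y) \<in> (\<lambda>x. (x, T x)) ` H" unfolding G(2) using s_H by simp
  then have "T s = y" by auto
  moreover have "\<beta> i = r i" if "i < k" for i using that \<alpha> by (intro \<beta>(2)) simp
  ultimately show ?thesis using that s_H s3 by blast
qed

lemma lift_nhd:
  assumes "c > 0"
  obtains U where "open U" "0 \<in> U"
    "\<And>y. y \<in> U \<Longrightarrow> \<exists>\<alpha> u. (\<forall>i<k. \<alpha> i = r i) \<and> u \<in> H \<and> u \<in> (*\<^sub>R) c ` A \<alpha> \<and> T u = y"
proof
  \<comment> \<open>\<open>Suc k\<close> rather than \<open>k\<close>, because the neighbourhood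
    hypothesis starts at length 1 and \<open>k = 0\<close> is allowed here. The scaling by
    \<open>c / 3\<close> absorbs the 3 of \<open>lift_closure\<close>.\<close>
  let ?C = "closure (prefix_image T H A (map r [0..<Suc k]))"
  let ?U = "interior ((*\<^sub>R) (c / 3) ` ?C)"
  show "open ?U" by simp
  show "0 \<in> ?U" using assms by (intro E.interior_scaleR prefix_image_nhd) auto
  fix y assume "y \<in> ?U"
  then obtain v where v: "v \<in> ?C" "y = (c / 3) *\<^sub>R v" using interior_subset by blast
  from lift_closure[OF _ v(1)] obtain \<alpha> u where
    u: "\<And>i. i < Suc k \<Longrightarrow> \<alpha> i = r i" "u \<in> H" "u \<in> (*\<^sub>R) 3 ` A \<alpha>" "T u = v" by auto
  have "(c / 3) *\<^sub>R u \<in> (*\<^sub>R) c ` A \<alpha>" using u(3) by auto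
  then show "\<exists>\<alpha> u. (\<forall>i<k. \<alpha> i = r i) \<and> u \<in> H \<and> u \<in> (*\<^sub>R) c ` A \<alpha> \<and> T u = y"
    using u v F.subspace_scaleR[OF H_subspace u(2), of "c / 3"]
    by (intro exI[of _ \<alpha>] exI[of _ "(c / 3) *\<^sub>R u"]) (auto simp: T_scaleR)
qed

section \<open>Lifting Cauchy sequences\<close>

lemma Cauchy_lift_differences:
  assumes "Cauchy y"
  shows "\<exists>N. \<forall>n\<ge>N. \<forall>m\<ge>N. \<exists>\<alpha> u. (\<forall>i<k. \<alpha> i = r i) \<and> u \<in> H \<and> u \<in> (*\<^sub>R) (1 / 2 ^ k) ` A \<alpha> \<and>
    T u = y m - y n"
proof -
  have "(0::real) < 1 / 2 ^ k" by simp
  then obtain U where U: "open U" "0 \<in> U"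
    "\<And>y. y \<in> U \<Longrightarrow> \<exists>\<alpha> u. (\<forall>i<k. \<alpha> i = r i) \<and> u \<in> H \<and> u \<in> (*\<^sub>R) (1 / 2 ^ k) ` A \<alpha> \<and> T u = y"
    using lift_nhd[of "1 / 2 ^ k" k] by metis
  show ?thesis using Cauchy_diff_in_nhd[OF assms U(1,2)] U(3) by meson
qed

text \<open>Surjectivity alone gives no control of the prefix; this suffices for the starting value
  and at level 0. The factor 1 matches the form of \<open>A_mult_mono\<close>.\<close>

lemma lift_single: obtains \<alpha> u where "u \<in> H" "u \<in> (*\<^sub>R) 1 ` A \<alpha>" "T u = y"
proof -
  obtain u where u: "u \<in> H" "T u = y" using T_surj by (metis UNIV_I imageE)
  have "u \<in> (\<Union>\<alpha>. A \<alpha>)" using A by (simp add: quasi_LB_representation_def)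
  then obtain \<alpha> where "u \<in> A \<alpha>" by blast
  then show ?thesis using u by (intro that[of u \<alpha>]) auto
qed

text \<open>Write \<open>y n\<close> as \<open>y (N 0)\<close>, plus the increments along the
  subsequence \<open>N\<close> up to level \<open>\<kappa> n\<close>, plus a remainder. Each piece
  is lifted separately. All indices have one upper bound \<open>\<beta>\<close>, so the lifted
  increments are summable in the space of \<open>A \<beta>\<close> and the lifted remainders tend to
  0 there.\<close>

lemma Cauchy_lift:
  assumes y: "Cauchy y"
  obtains u where "range u \<subseteq> H" "fast_convergent scaleF u" "\<And>n. T (u n) = y n"
proof -
  let ?L = "\<lambda>k z \<alpha> u. (\<forall>i<k. \<alpha> i = r i) \<and> u \<in> H \<and> u \<in> (*\<^sub>R) (1 / 2 ^ k) ` A \<alpha> \<and> T u = z"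
  have "\<exists>N. \<forall>n\<ge>N. \<forall>m\<ge>N. \<exists>\<alpha> u. ?L k (y m - y n) \<alpha> u" for k
    by (rule Cauchy_lift_differences[OF y])
  then obtain M where M: "\<And>k n m. n \<ge> M k \<Longrightarrow> m \<ge> M k \<Longrightarrow> \<exists>\<alpha> u. ?L k (y m - y n) \<alpha> u"
    by metis
  \<comment> \<open>The sum makes \<open>N\<close> monotone and at least \<open>M k\<close> for
    \<open>k \<ge> 1\<close>; the summand \<open>k\<close> makes it unbounded. Leaving out
    \<open>M 0\<close> gives \<open>N 0 = 0\<close>, so every \<open>n\<close> has reached level 0,
    where the prefix is empty and \<open>lift_single\<close> applies.\<close>
  define N where "N k = k + (\<Sum>i\<in>{1..k}. M i)" for k
  have N_mono: "N i \<le> N k" if "i \<le> k" for i k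
    unfolding N_def using that by (intro add_mono sum_mono2) auto
  have N_ge: "k \<le> N k" for k by (simp add: N_def)
  have diff: "\<exists>\<alpha> u. ?L k (y m - y n) \<alpha> u" if "n \<ge> N k" "m \<ge> N k" for k n m
  proof (cases "k = 0")
    case True
    obtain \<alpha> u where "u \<in> H" "u \<in> (*\<^sub>R) 1 ` A \<alpha>" "T u = y m - y n" by (rule lift_single)
    then show ?thesis using True by auto
  next
    case False
    then have "M k \<le> N k"
      unfolding N_def using member_le_sum[of k "{1..k}" M] by (simp add: trans_le_add2)
    then show ?thesis using that by (intro M) auto
  qed
  \<comment> \<open>The greatest element exists because level 0 qualifies and no level above
    \<open>n\<close> does.\<close>
  define \<kappa> where "\<kappa> n = (GREATEST k. N k \<le> n)" for n
  have bound: "k \<le> n" if "N k \<le> n" for k n using that N_ge[of k] by simp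
  have \<kappa>: "N (\<kappa> n) \<le> n" for n
    unfolding \<kappa>_def by (rule GreatestI_nat[of _ 0 n]) (simp add: N_def, rule bound)
  have \<kappa>_ge: "k \<le> \<kappa> n" if "N k \<le> n" for k n
    unfolding \<kappa>_def using that by (rule Greatest_le_nat[of _ _ n]) (rule bound)
  have "\<exists>\<alpha> u. ?L k (y (N (Suc k)) - y (N k)) \<alpha> u" for k
    by (rule diff) (auto intro: N_mono)
  then obtain \<alpha> w where \<alpha>: "\<And>k i. i < k \<Longrightarrow> \<alpha> k i = r i"
    and w: "\<And>k. w k \<in> H" "\<And>k. w k \<in> (*\<^sub>R) (1 / 2 ^ k) ` A (\<alpha> k)"
      "\<And>k. T (w k) = y (N (Suc k)) - y (N k)"
    by metis
  have "\<exists>\<alpha> u. ?L (\<kappa> n) (y n - y (N (\<kappa> n))) \<alpha> u" for n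
    by (rule diff) (auto intro: \<kappa>)
  then obtain \<gamma> d where \<gamma>: "\<And>n i. i < \<kappa> n \<Longrightarrow> \<gamma> n i = r i"
    and d: "\<And>n. d n \<in> H" "\<And>n. d n \<in> (*\<^sub>R) (1 / 2 ^ \<kappa> n) ` A (\<gamma> n)"
      "\<And>n. T (d n) = y n - y (N (\<kappa> n))"
    by metis
  obtain \<pi> p where p: "p \<in> H" "p \<in> (*\<^sub>R) 1 ` A \<pi>" "T p = y (N 0)" by (rule lift_single)
  have "\<forall>\<^sub>F k in sequentially. \<alpha> k i = r i" for i
    using \<alpha> by (auto simp: eventually_sequentially intro!: exI[of _ "Suc i"])
  then obtain \<alpha>' where \<alpha>': "\<And>k. \<alpha> k \<le> \<alpha>'"
    using eventually_fixed_upper_bound[of \<alpha> r] by blast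
  \<comment> \<open>The prefix fixed in \<open>\<gamma> n\<close> has length
    \<open>\<kappa> n\<close>, which exceeds \<open>i\<close> as soon as
    \<open>N (Suc i) \<le> n\<close>.\<close>
  have "\<forall>\<^sub>F n in sequentially. \<gamma> n i = r i" for i
    using \<gamma> \<kappa>_ge[of "Suc i"] unfolding eventually_sequentially Suc_le_eq by blast
  then obtain \<gamma>' where \<gamma>': "\<And>n. \<gamma> n \<le> \<gamma>'"
    using eventually_fixed_upper_bound[of \<gamma> r] by blast
  define \<beta> where "\<beta> = sup (sup \<alpha>' \<gamma>') \<pi>"
  have \<beta>: "\<alpha> k \<le> \<beta>" "\<gamma> n \<le> \<beta>" "\<pi> \<le> \<beta>" for k n
    using \<alpha>'[of k] \<gamma>'[of n] unfolding \<beta>_def by (auto intro: le_supI1 le_supI2)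
  have w\<beta>: "w k \<in> (*\<^sub>R) (1 / 2 ^ k) ` A \<beta>" for k
    by (rule A_mult_mono[OF _ _ \<beta>(1) w(2)]) auto
  have d\<beta>: "d n \<in> (*\<^sub>R) (1 / 2 ^ \<kappa> n) ` A \<beta>" for n
    by (rule A_mult_mono[OF _ _ \<beta>(2) d(2)]) auto
  have p\<beta>: "p \<in> (*\<^sub>R) 1 ` A \<beta>"
    by (rule A_mult_mono[OF _ _ \<beta>(3) p(2)]) auto
  obtain s where s: "\<And>n. s - (\<Sum>j<n. w j) \<in> (*\<^sub>R) (3 * 1 / 2 ^ n) ` A \<beta>"
    using F.banach_disk_geometric_sum[OF A_banach zero_less_one w\<beta>] by blast
  define u where "u n = p + (\<Sum>j<\<kappa> n. w j) + d n" for n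
  have S_H: "(\<Sum>j<n. w j) \<in> H" for n by (rule F.subspace_sum[OF H_subspace w(1)])
  have u_H: "range u \<subseteq> H"
    unfolding u_def using p d S_H by (auto intro!: F.subspace_add[OF H_subspace])
  have T_S: "T (\<Sum>j<n. w j) = y (N n) - y (N 0)" for n
    unfolding T_sum[OF w(1)] w(3) by (rule sum_lessThan_telescope)
  have T_u: "T (u n) = y n" for n
    unfolding u_def using p d S_H by (simp add: T_add F.subspace_add[OF H_subspace] T_S)
  have s_span: "s \<in> F.span (A \<beta>)" using F.disk_mult_subset_span[OF s[of 0]] by simp
  have ps_span: "p + s \<in> F.span (A \<beta>)"
    by (intro F.span_add s_span F.disk_mult_subset_span[OF p\<beta>])
  \<comment> \<open>The 4 is 1 for the lifted remainder \<open>d n\<close> plus 3 for the tail of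
    the series.\<close>
  have u_lim: "u n - (p + s) \<in> (*\<^sub>R) (4 / 2 ^ \<kappa> n) ` A \<beta>" for n
  proof -
    have "d n - (s - (\<Sum>j<\<kappa> n. w j)) \<in> (*\<^sub>R) (1 / 2 ^ \<kappa> n + 3 * 1 / 2 ^ \<kappa> n) ` A \<beta>"
      by (intro F.disk_mult_diff[OF A_disk] d\<beta> s) auto
    then show ?thesis by (simp add: u_def algebra_simps flip: add_divide_distrib)
  qed
  have \<kappa>_top: "filterlim \<kappa> at_top sequentially"
    unfolding filterlim_at_top eventually_sequentially using \<kappa>_ge by blast
  have "(\<lambda>k. 4 / 2 ^ k :: real) \<longlonglongrightarrow> 0" using LIMSEQ_divide_realpow_zero[of 2 4] by simp
  then have \<kappa>_lim: "(\<lambda>n. 4 / 2 ^ \<kappa> n :: real) \<longlonglongrightarrow> 0"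
    by (rule filterlim_compose[OF _ \<kappa>_top])
  have "limitin (disk_topology scaleF (A \<beta>)) u (p + s) sequentially"
    by (rule F.limitin_disk_topology[OF A_disk A_bounded ps_span u_lim \<kappa>_lim])
  moreover have "range u \<subseteq> F.span (A \<beta>)"
    using F.span_add[OF F.disk_mult_subset_span[OF u_lim] ps_span] by fastforce
  ultimately have "fast_convergent scaleF u"
    unfolding fast_convergent_def using A_banach by blast
  then show ?thesis using that u_H T_u by blast
qed

section \<open>Lifting subsets of disked hulls\<close>

lemma disk_image:
  assumes D: "disk scaleF D" "D \<subseteq> H"
  shows "disk scaleE (T ` D)"
proof -
  have "convex (T ` D)"
  proof (rule convexI)
    fix x y and a b :: real
    assume xy: "x \<in> T ` D" "y \<in> T ` D" and ab: "0 \<le> a" "0 \<le> b" "a + b = 1"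
    then obtain v w where vw: "v \<in> D" "w \<in> D" "x = T v" "y = T w" by blast
    then have H: "v \<in> H" "w \<in> H" using D by auto
    have "a *\<^sub>R v + b *\<^sub>R w \<in> D"
      using D vw ab by (intro convexD) (auto simp: disk_def)
    moreover have "T (a *\<^sub>R v + b *\<^sub>R w) = a *\<^sub>R x + b *\<^sub>R y"
      using vw H by (simp add: T_add T_scaleR F.subspace_scaleR[OF H_subspace])
    ultimately show "a *\<^sub>R x + b *\<^sub>R y \<in> T ` D" by (metis imageI)
  qed
  moreover have "scaleE c ` T ` D \<subseteq> T ` D" if "norm c \<le> 1" for c
  proof -
    have "scaleE c (T x) \<in> T ` D" if "x \<in> D" for x
      using that disk_scaleD[OF D(1) \<open>norm c \<le> 1\<close> that] D(2) T_scale[of x c] by (metis imageI subsetD)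
    then show ?thesis by blast
  qed
  ultimately show ?thesis using D(1) unfolding disk_def by blast
qed

text \<open>Lift \<open>x\<close> to a fast convergent sequence. The disked hull of the lift is fast
  precompact, and its image is a disk containing \<open>x\<close>, hence covers the disked hull of
  \<open>x\<close>.\<close>

lemma lift_subset_disk_hull:
  assumes x: "Cauchy x" and P: "P \<subseteq> disk scaleE hull range x"
  shows "\<exists>Q\<subseteq>H. fast_precompact scaleF Q \<and> T ` Q = P"
proof -
  obtain u where u: "range u \<subseteq> H" "fast_convergent scaleF u" "\<And>n. T (u n) = x n"
    using Cauchy_lift[OF x] by metis
  obtain B l where B: "banach_disk scaleF B" "range u \<subseteq> F.span B"
    "limitin (disk_topology scaleF B) u l sequentially"
    using u(2) unfolding fast_convergent_def by blast
  then have B': "disk scaleF B" "tvs_bounded scaleF B" by (auto simp: banach_disk_def)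
  interpret Metric_space "F.span B" "disk_dist scaleF B" by (rule F.Metric_space_disk[OF B'])
  define K where "K = disk scaleF hull range u"
  \<comment> \<open>Restricting \<open>K\<close> to the preimage of \<open>P\<close> makes the image
    exactly \<open>P\<close> and preserves total boundedness.\<close>
  define Q where "Q = {v \<in> K. T v \<in> P}"
  have K_H: "K \<subseteq> H"
    unfolding K_def by (intro hull_minimal u F.subspace_imp_disk H_subspace)
  have "disk scaleE hull range x \<subseteq> T ` K"
  proof (rule hull_minimal)
    have "u n \<in> K" for n unfolding K_def by (simp add: hull_inc)
    then show "range x \<subseteq> T ` K" using u(3) by (metis image_eqI image_subsetI)
    show "disk scaleE (T ` K)" using K_H unfolding K_def by (intro disk_image F.disk_hull)
  qed
  then have "T ` Q = P" using P unfolding Q_def by blast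
  moreover have "mtotally_bounded Q"
    using F.mtotally_bounded_disk_hull[OF B' B(2,3)]
    by (rule mtotally_bounded_subset) (auto simp: Q_def K_def)
  then have "fast_precompact scaleF Q"
    unfolding fast_precompact_def using B(1) mtotally_bounded_imp_subset by blast
  moreover have "Q \<subseteq> H" using K_H unfolding Q_def by blast
  ultimately show ?thesis by (intro exI[of _ Q]) simp
qed

end

text \<open>Parts (a) and (c) are instances of \<open>Cauchy_lift\<close>. Part (b) applies
  \<open>lift_subset_disk_hull\<close> to the null sequence whose disked hull contains
  \<open>P\<close>.\<close>

theorem theorem1:
  fixes scaleE :: "'k::real_or_complex \<Rightarrow> 'e \<Rightarrow>
      'e::{real_vector, topological_ab_group_add, uniform_topological_group_add, t2_space}"
    and scaleF :: "'k \<Rightarrow> 'f \<Rightarrow>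
      'f::{real_vector, topological_ab_group_add, uniform_topological_group_add, t2_space}"
    and A :: "(nat \<Rightarrow> nat) \<Rightarrow> 'f set"
    and H :: "'f set"
    and T :: "'f \<Rightarrow> 'e"
  assumes E: "hausdorff_lcs scaleE"
    and F: "hausdorff_lcs scaleF"
    and A: "quasi_LB_representation scaleF A"
    and web: "\<exists>W. sequential_web scaleE W"
    and H_subspace: "module.subspace scaleF H"
    and H_closed: "fast_closed scaleF H"
    and T_add: "\<And>x y. \<lbrakk>x \<in> H; y \<in> H\<rbrakk> \<Longrightarrow> T (x + y) = T x + T y"
    and T_scale: "\<And>c x. x \<in> H \<Longrightarrow> T (scaleF c x) = scaleE c (T x)"
    and T_surj: "T ` H = UNIV"
    and T_graph: "closedin (top_of_set (H \<times> UNIV)) ((\<lambda>x. (x, T x)) ` H)"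
    and V: "\<exists>r :: nat \<Rightarrow> nat. \<forall>k\<ge>1.
      0 \<in> interior (closure (prefix_image T H A (map r [0..<k])))"
  shows "(\<forall>y :: nat \<Rightarrow> 'e. convergent y \<longrightarrow>
           (\<exists>u. range u \<subseteq> H \<and> fast_convergent scaleF u \<and> (\<forall>n. T (u n) = y n)))
       \<and> ((\<forall>P :: 'e set. totally_bounded P \<longrightarrow>
             (\<exists>x :: nat \<Rightarrow> 'e. x \<longlonglongrightarrow> 0 \<and> P \<subseteq> disk scaleE hull range x)) \<longrightarrow>
           (\<forall>P :: 'e set. totally_bounded P \<longrightarrow>
             (\<exists>Q. Q \<subseteq> H \<and> fast_precompact scaleF Q \<and> T ` Q = P)))
       \<and> (metrizable_space (euclidean :: 'e topology) \<longrightarrow>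
           (\<forall>y :: nat \<Rightarrow> 'e. Cauchy y \<longrightarrow>
             (\<exists>u. range u \<subseteq> H \<and> fast_convergent scaleF u \<and> (\<forall>n. T (u n) = y n))))"
proof -
  obtain r where r: "\<And>k. k \<ge> 1 \<Longrightarrow> 0 \<in> interior (closure (prefix_image T H A (map r [0..<k])))"
    using V by blast
  interpret E: hausdorff_lcs scaleE by (rule E)
  interpret F: hausdorff_lcs scaleF by (rule F)
  interpret quasi_LB_surjection scaleE scaleF A H T r
    by unfold_locales (fact A H_subspace H_closed T_add T_scale T_surj T_graph r)+
  have lift: "\<exists>u. range u \<subseteq> H \<and> fast_convergent scaleF u \<and> (\<forall>n. T (u n) = y n)" if "Cauchy y" for y
    using Cauchy_lift[OF that] by metis
  show ?thesis
  proof (intro conjI allI impI)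
    fix y :: "nat \<Rightarrow> 'e" assume "convergent y"
    then show "\<exists>u. range u \<subseteq> H \<and> fast_convergent scaleF u \<and> (\<forall>n. T (u n) = y n)"
      by (intro lift) (auto simp: convergent_def intro: LIMSEQ_imp_Cauchy)
  next
    fix P :: "'e set"
    assume "\<forall>P :: 'e set. totally_bounded P \<longrightarrow> (\<exists>x. x \<longlonglongrightarrow> 0 \<and> P \<subseteq> disk scaleE hull range x)"
      and "totally_bounded P"
    then obtain x where "x \<longlonglongrightarrow> 0" "P \<subseteq> disk scaleE hull range x" by blast
    then show "\<exists>Q\<subseteq>H. fast_precompact scaleF Q \<and> T ` Q = P"
      by (intro lift_subset_disk_hull LIMSEQ_imp_Cauchy)
  qed (rule lift)
qed

end
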